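(* For every integer $d\geq 7$, the chiseling $\mathrm{ch}([-1,1]^d,1)$ of the $d$-dimensional cube $[-1,1]^d$ is Ehrhart unimodal but not Ehrhart positive.
   Context: Chiseling off a vertex $v$ of a $d$-dimensional lattice polytope $P\subset\mathbb{R}^d$ (with exactly $d$ edges at $v$, having primitive edge directions $u_1,\ldots,u_d$ forming a lattice basis of $\mathbb{Z}^d$) at distance $b\in\mathbb{Z}_{>0}$ means replacing $P$ by $\mathrm{conv}\big((\mathrm{Vert}(P)\setminus\{v\})\cup\{v+bu_1,\ldots,v+bu_d\}\big)$. The full chiseling $\mathrm{ch}(P,b)$ is the polytope obtained by chiseling off every vertex of $P$ at distance $b$, i.e. the convex hull of all points $v+bu$ where $v$ is a vertex of $P$ and $u$ is a primitive edge direction of $P$ at $v$ (pointing from $v$ into $P$). In particular, $\mathrm{ch}([-1,1]^d,1)$ is the convex hull of the midpoints of the edges of $[-1,1]^d$, that is, of all points of $\{-1,0,1\}^d$ having exactly one coordinate equal to $0$. For a $d$-dimensional lattice polytope $P\subset\mathbb{R}^n$ (the convex hull of finitely many points of $\mathbb{Z}^n$, with $d$-dimensional affine span) and $t\in\mathbb{Z}_{\geq 0}$, let $tP=\{tp : p\in P\}$ and $i(P;t)=|tP\cap\mathbb{Z}^n|$; this is a polynomial in $t$ of degree $d$ (the Ehrhart polynomial). The $h^\ast$-polynomial $h^\ast(P;z)=h_0^\ast+h_1^\ast z+\cdots+h_d^\ast z^d$ is defined by $\sum_{t\geq 0} i(P;t)z^t = h^\ast(P;z)/(1-z)^{d+1}$.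 $P$ is Ehrhart positive if all coefficients (of $t^0,\dots,t^d$) of $i(P;t)$ are positive (strictly greater than $0$). $P$ is Ehrhart unimodal if there is an index $m\in\{0,1,\ldots,d\}$ with $h_0^\ast\leq\cdots\leq h_m^\ast\geq\cdots\geq h_d^\ast$. *)

theory Defs
  imports "HOL-Analysis.Analysis" "HOL-Computational_Algebra.Computational_Algebra"
begin

text \<open>
  A statement about polytopes in \<open>d\<close>-dimensional space is phrased over the type \<open>real^'n\<close> with
  \<open>d = CARD('n)\<close>; vertices and edges are the library's \<^const>\<open>extreme_point_of\<close> and
  \<^const>\<open>edge_of\<close> (a face of affine dimension 1).
\<close>

definition int_lattice :: "(real^'n) set" where
  "int_lattice = {x. \<forall>i. x $ i \<in> \<int>}"

definition primitive_vector :: "real^'n \<Rightarrow> bool" where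
  "primitive_vector u \<longleftrightarrow> (\<exists>a :: int^'n. (\<forall>i. u $ i = of_int (a $ i)) \<and> Gcd (range (($) a)) = 1)"

text \<open>The side condition \<open>l > 0\<close> makes the direction point from \<open>v\<close> into \<open>P\<close>.\<close>

definition primitive_edge_direction :: "(real^'n) set \<Rightarrow> real^'n \<Rightarrow> real^'n \<Rightarrow> bool" where
  "primitive_edge_direction P v u \<longleftrightarrow>
     primitive_vector u \<and> (\<exists>l>0. closed_segment v (v + l *\<^sub>R u) edge_of P)"

definition chiseling :: "(real^'n) set \<Rightarrow> nat \<Rightarrow> (real^'n) set" where
  "chiseling P b =
     convex hull {v + real b *\<^sub>R u | v u. v extreme_point_of P \<and> primitive_edge_direction P v u}"

definition cube :: "(real^'n) set" where
  "cube = cbox (\<chi> i. -1) (\<chi> i. 1)"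

definition lattice_count :: "(real^'n) set \<Rightarrow> nat \<Rightarrow> nat" where
  "lattice_count P t = card ((*\<^sub>R) (real t) ` P \<inter> int_lattice)"

text \<open>
  In the next two definitions uniqueness always holds; existence holds for lattice polytopes.
\<close>

definition ehrhart_poly :: "(real^'n) set \<Rightarrow> real poly" where
  "ehrhart_poly P = (THE p. \<forall>t::nat. poly p (real t) = real (lattice_count P t))"

definition hstar_poly :: "(real^'n) set \<Rightarrow> real poly" where
  "hstar_poly P = (THE h.
     Abs_fps (\<lambda>t. real (lattice_count P t)) =
       fps_of_poly h / (1 - fps_X) ^ (nat (aff_dim P) + 1))"

definition ehrhart_positive :: "(real^'n) set \<Rightarrow> bool" where
  "ehrhart_positive P \<longleftrightarrow> (\<forall>k\<le>nat (aff_dim P). coeff (ehrhart_poly P) k > 0)"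

definition ehrhart_unimodal :: "(real^'n) set \<Rightarrow> bool" where
  "ehrhart_unimodal P \<longleftrightarrow>
     (\<exists>m\<le>nat (aff_dim P).
        (\<forall>k<m. coeff (hstar_poly P) k \<le> coeff (hstar_poly P) (Suc k)) \<and>
        (\<forall>k. m \<le> k \<and> k < nat (aff_dim P) \<longrightarrow>
           coeff (hstar_poly P) (Suc k) \<le> coeff (hstar_poly P) k))"

end

theory Submission imports Defs begin

text \<open>
  Write \<open>d\<close> for the dimension. Chiseling leaves the convex hull of the midpoints of the edges of
  the cube, and this is the cube intersected with \<open>\<bar>x\<^sub>1\<bar> + \<dots> + \<bar>x\<^sub>d\<bar> \<le> d - 1\<close>
  (\<open>chiseling_cube_eq_hull\<close>, \<open>hull_edge_midpoints\<close>). A lattice point \<open>f\<close> of the \<open>t\<close>-th dilate of the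
  cube is lost exactly if the numbers \<open>y\<^sub>i = t - \<bar>f\<^sub>i\<bar> \<ge> 0\<close> have sum less than \<open>t\<close>. Such a point has no zero
  entry, so each of the \<open>(t + d - 1) choose d\<close> tuples \<open>y\<close> comes from \<open>2\<^sup>d\<close> points and the Ehrhart
  polynomial is
    \<open>(2 t + 1)\<^sup>d - 2\<^sup>d ((t + d - 1) choose d)\<close>   (\<open>lattice_count_cut_cube_eq\<close>).

  Its linear coefficient is \<open>2 d - 2\<^sup>d / d\<close>, because the binomial coefficient, divided by \<open>t\<close>, takes the
  value \<open>(d - 1)! / d!\<close> at \<open>t = 0\<close>. From \<open>d = 7\<close> on this is negative.

  The generating function of \<open>(2 t + 1)\<^sup>d\<close> is the type B Eulerian polynomial \<open>B\<^sub>d\<close> over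
  \<open>(1 - z)\<^sup>d\<^sup>+\<^sup>1\<close>, and that of the binomial coefficients is \<open>z / (1 - z)\<^sup>d\<^sup>+\<^sup>1\<close>. Hence the \<open>h\<^sup>*\<close>-polynomial is
  \<open>B\<^sub>d - 2\<^sup>d z\<close>. The coefficients of \<open>B\<^sub>d\<close> are symmetric and grow up to the middle. Lowering the
  one of \<open>z\<close> by \<open>2\<^sup>d\<close> preserves this growth: it stays at least 1, the constant coefficient
  (\<open>eulerB_1_ge\<close>), and it lies before the peak at \<open>d div 2\<close>.
\<close>

section \<open>The edges of the cube\<close>

text \<open>
  Stated for arbitrary boxes because it serves both the cube and the box spanned by a point of
  \<open>cut_cube\<close> in \<open>hull_edge_midpoints\<close>.
\<close>

lemma extreme_point_of_cbox_coord:
  fixes a b x :: "real^'n"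
  assumes "x extreme_point_of cbox a b"
  shows "x $ i = a $ i \<or> x $ i = b $ i"
proof (rule ccontr)
  assume neq: "\<not> ?thesis"
  have x: "x \<in> cbox a b" using assms by (simp add: extreme_point_of_def)
  then have lt: "a $ i < x $ i" "x $ i < b $ i"
    using neq by (auto simp: mem_box_cart order.strict_iff_order)
  define p q :: "real^'n" where "p = (\<chi> j. if j = i then a $ i else x $ j)"
    and "q = (\<chi> j. if j = i then b $ i else x $ j)"
  define u where "u = (x $ i - a $ i) / (b $ i - a $ i)"
  have "p \<in> cbox a b" "q \<in> cbox a b"
    using x lt unfolding p_def q_def mem_box_cart by auto
  moreover have "x \<in> open_segment p q"
    unfolding in_segment
  proof (intro conjI exI)
    show "p \<noteq> q" using lt by (auto simp: p_def q_def vec_eq_iff intro!: exI[of _ i])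
    show "0 < u" "u < 1" using lt by (auto simp: u_def field_simps)
    have "u * (b $ i - a $ i) = x $ i - a $ i" using lt by (simp add: u_def)
    then show "x = (1 - u) *\<^sub>R p + u *\<^sub>R q"
      by (auto simp: p_def q_def vec_eq_iff algebra_simps)
  qed
  ultimately show False using assms by (auto simp: extreme_point_of_def)
qed

lemma convex_comb_eq_1D:
  fixes a b c u :: real
  assumes "c * a + u * b = 1" "a \<le> 1" "b \<le> 1" "0 < c" "0 < u" "c + u = 1"
  shows "a = 1 \<and> b = 1"
proof -
  have le: "c * a \<le> c" "u * b \<le> u"
    using assms mult_left_mono[of a 1 c] mult_left_mono[of b 1 u] by auto
  then have "c * a = c" "u * b = u" using assms(1,6) by linarith+
  then show ?thesis using assms(4,5) by simp
qed

lemma unit_eq_convex_comb: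
  fixes a b u :: real
  assumes "\<bar>(1 - u) * a + u * b\<bar> = 1" "\<bar>a\<bar> \<le> 1" "\<bar>b\<bar> \<le> 1" "0 < u" "u < 1"
  shows "a = b"
proof -
  consider "(1 - u) * a + u * b = 1" | "(1 - u) * (- a) + u * (- b) = 1"
    using assms(1) by (auto simp: abs_if split: if_splits)
  then show ?thesis
    using convex_comb_eq_1D[of "1 - u" a u b] convex_comb_eq_1D[of "1 - u" "- a" u "- b"] assms by cases (auto simp: abs_le_iff)
qed

lemma mem_cube: "x \<in> (cube :: (real^'n) set) \<longleftrightarrow> (\<forall>i. \<bar>x $ i\<bar> \<le> 1)"
  unfolding cube_def mem_box_cart by (auto simp: abs_le_iff minus_le_iff)

text \<open>
  A coordinate of absolute value 1 is extremal in the cube, hence constant on any open segment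
  through the point. This is what makes the vertices extreme and the edges faces.
\<close>

lemma open_segment_cube_coord:
  fixes x a b :: "real^'n"
  assumes "x \<in> open_segment a b" "a \<in> cube" "b \<in> cube" "\<bar>x $ i\<bar> = 1"
  shows "a $ i = x $ i" "b $ i = x $ i"
proof -
  from assms(1) obtain u where u: "0 < u" "u < 1" "x = (1 - u) *\<^sub>R a + u *\<^sub>R b"
    unfolding in_segment by blast
  then have x: "x $ i = (1 - u) * a $ i + u * b $ i" by simp
  then have "a $ i = b $ i"
    using unit_eq_convex_comb[of u "a $ i" "b $ i"] assms u by (auto simp: mem_cube)
  then show "a $ i = x $ i" "b $ i = x $ i" using x by (simp_all add: algebra_simps)
qed

lemma extreme_point_of_cube:
  fixes v :: "real^'n"
  shows "v extreme_point_of cube \<longleftrightarrow> (\<forall>i. \<bar>v $ i\<bar> = 1)"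
proof
  assume v: "v extreme_point_of cube"
  show "\<forall>i. \<bar>v $ i\<bar> = 1"
  proof
    fix i
    have "v $ i = - 1 \<or> v $ i = 1"
      using extreme_point_of_cbox_coord[OF v[unfolded cube_def], of i] by simp
    then show "\<bar>v $ i\<bar> = 1" by auto
  qed
next
  assume v: "\<forall>i. \<bar>v $ i\<bar> = 1"
  have "v \<notin> open_segment a b" if "a \<in> cube" "b \<in> cube" for a b
  proof
    assume "v \<in> open_segment a b"
    then have "a = b" using open_segment_cube_coord[of v a b] that v by (simp add: vec_eq_iff)
    then show False using \<open>v \<in> open_segment a b\<close> by simp
  qed
  then show "v extreme_point_of cube" using v by (auto simp: extreme_point_of_def mem_cube)
qed

text \<open>
  If an edge joined vertices differing in two coordinates \<open>i\<close> and \<open>j\<close>, exchanging their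
  \<open>i\<close>-th entries would give two other vertices with the same midpoint, and the face property
  would put these on the edge too. So the ends of an edge differ in one coordinate only, and
  primitivity then fixes the length of the direction vector.
\<close>

lemma primitive_edge_direction_cubeD:
  fixes u v :: "real^'n"
  assumes v: "v extreme_point_of cube" and dir: "primitive_edge_direction cube v u"
  shows "\<exists>i. u = axis i (- (v $ i))"
proof -
  obtain l where l: "l > 0" and edge: "closed_segment v (v + l *\<^sub>R u) edge_of cube"
    and prim: "primitive_vector u"
    using dir unfolding primitive_edge_direction_def by blast
  define w where "w = v + l *\<^sub>R u"
  have face: "closed_segment v w face_of cube" and "aff_dim (closed_segment v w) = 1"
    using edge unfolding edge_of_def w_def by auto
  then have "v \<noteq> w" by auto
  then obtain i where i: "v $ i \<noteq> w $ i" by (auto simp: vec_eq_iff)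
  have "w extreme_point_of closed_segment v w" by (simp add: extreme_point_of_segment)
  then have w: "w extreme_point_of cube" using face by (simp add: extreme_point_of_face)
  have v1: "\<bar>v $ k\<bar> = 1" and w1: "\<bar>w $ k\<bar> = 1" for k
    using v w by (simp_all add: extreme_point_of_cube)
  have eq: "w $ j = v $ j" if "j \<noteq> i" for j
  proof (rule ccontr)
    assume j: "w $ j \<noteq> v $ j"
    \<comment> \<open>the pair \<open>v, w\<close> with the \<open>i\<close>-th entries exchanged, so with the same midpoint\<close>
    define v' w' where "v' = (\<chi> k. if k = i then w $ i else v $ k)"
      and "w' = (\<chi> k. if k = i then v $ i else w $ k)"
    have in_cube: "v' \<in> cube" "w' \<in> cube"
      using v1 w1 unfolding v'_def w'_def mem_cube by auto
    have "midpoint v w = midpoint v' w'"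
      by (auto simp: midpoint_def v'_def w'_def vec_eq_iff)
    moreover have "v' \<noteq> w'" using i unfolding v'_def w'_def vec_eq_iff by (auto intro!: exI[of _ i])
    ultimately have "midpoint v w \<in> open_segment v' w'" by simp
    then have "v' \<in> closed_segment v w"
      using face_ofD[OF face] in_cube midpoint_in_closed_segment by blast
    then obtain s where s: "v' = (1 - s) *\<^sub>R v + s *\<^sub>R w" unfolding in_segment by blast
    have "v' $ i = (1 - s) * v $ i + s * w $ i" "v' $ j = (1 - s) * v $ j + s * w $ j"
      using s by simp_all
    then have "(1 - s) * (w $ i - v $ i) = 0" "s * (v $ j - w $ j) = 0"
      using that by (simp_all add: v'_def algebra_simps)
    then show False using i j by simp
  qed
  have u0: "u $ j = 0" if "j \<noteq> i" for j
    using eq[OF that] l by (simp add: w_def)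
  have "w $ i = - (v $ i)" using i v1[of i] w1[of i] by linarith
  then have ui: "l * u $ i = - 2 * v $ i" by (simp add: w_def)
  obtain a :: "int^'n" where a: "\<And>k. u $ k = of_int (a $ k)" "Gcd (range (($) a)) = 1"
    using prim unfolding primitive_vector_def by blast
  have "a $ i dvd Gcd (range (($) a))"
  proof (rule Gcd_greatest)
    fix b assume "b \<in> range (($) a)"
    then obtain k where k: "b = a $ k" by blast
    show "a $ i dvd b" using u0[of k] a(1)[of k] k by (cases "k = i") auto
  qed
  then have "\<bar>a $ i\<bar> = 1" using a(2) by simp
  then have "\<bar>u $ i\<bar> = 1" using a(1)[of i] by linarith
  have "u $ i = - (v $ i)"
  proof (rule ccontr)
    assume "u $ i \<noteq> - (v $ i)"
    then have "u $ i = v $ i" using \<open>\<bar>u $ i\<bar> = 1\<close> v1[of i] by linarith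
    then have "(l + 2) * v $ i = 0" using ui by (simp add: algebra_simps)
    then show False using l v1[of i] by auto
  qed
  then have "u = axis i (- (v $ i))" using u0 by (auto simp: vec_eq_iff axis_def)
  then show ?thesis ..
qed

lemma primitive_edge_direction_cubeI:
  fixes v :: "real^'n"
  assumes v: "v extreme_point_of cube"
  shows "primitive_edge_direction cube v (axis i (- (v $ i)))"
proof -
  have v1: "\<bar>v $ k\<bar> = 1" for k
    using v by (simp add: extreme_point_of_cube)
  let ?u = "axis i (- (v $ i))"
  have "primitive_vector ?u"
    unfolding primitive_vector_def
  proof (intro exI conjI allI)
    define c :: int where "c = (if v $ i = 1 then -1 else 1)"
    have c: "of_int c = - (v $ i)" using v1[of i] by (auto simp: c_def)
    show "?u $ k = of_int (axis i c $ k)" for k by (auto simp: axis_def c)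
    have "Gcd (range (($) (axis i c))) dvd (axis i c :: int^'n) $ i"
      by (intro Gcd_dvd rangeI)
    also have "(axis i c :: int^'n) $ i = c" by (simp add: axis_def)
    also have "c dvd 1" by (simp add: c_def)
    finally show "Gcd (range (($) (axis i c :: int^'n))) = 1" by simp
  qed
  moreover have "closed_segment v (v + 2 *\<^sub>R ?u) edge_of cube"
  proof -
    let ?F = "{y \<in> cube. \<forall>j. j \<noteq> i \<longrightarrow> y $ j = v $ j}"
    have F: "closed_segment v (v + 2 *\<^sub>R ?u) = ?F"
    proof (intro equalityI subsetI)
      fix y assume "y \<in> closed_segment v (v + 2 *\<^sub>R ?u)"
      then obtain s where s: "0 \<le> s" "s \<le> 1" "y = (1 - s) *\<^sub>R v + s *\<^sub>R (v + 2 *\<^sub>R ?u)"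
        unfolding in_segment by blast
      have eq: "y $ j = v $ j" if "j \<noteq> i" for j
        using that s by (simp add: axis_def algebra_simps)
      have "y $ i = (1 - 2 * s) * v $ i"
        using s by (simp add: axis_def algebra_simps)
      then have "\<bar>y $ i\<bar> \<le> 1" using s v1[of i] by (simp add: abs_mult)
      then have "\<bar>y $ j\<bar> \<le> 1" for j using eq[of j] v1[of j] by (cases "j = i") auto
      then show "y \<in> ?F" using eq by (simp add: mem_cube)
    next
      fix y assume y: "y \<in> ?F"
      define s where "s = (1 - y $ i * v $ i) / 2"
      have "\<bar>y $ i * v $ i\<bar> \<le> 1" using y v1[of i] by (simp add: abs_mult mem_cube)
      then have s: "0 \<le> s" "s \<le> 1" by (auto simp: s_def)
      have "v $ i * v $ i = 1" using v1[of i] by (cases "v $ i \<ge> 0") (auto simp: abs_if)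
      moreover have "1 - 2 * s = y $ i * v $ i" by (simp add: s_def field_simps)
      ultimately have "y $ i = (1 - 2 * s) * v $ i" by (simp add: mult.assoc)
      then have "y = (1 - s) *\<^sub>R v + s *\<^sub>R (v + 2 *\<^sub>R ?u)"
        using y by (auto simp: vec_eq_iff axis_def algebra_simps)
      then show "y \<in> closed_segment v (v + 2 *\<^sub>R ?u)" using s unfolding in_segment by blast
    qed
    have "?F face_of cube"
      unfolding face_of_def
    proof (intro conjI ballI impI)
      show "convex ?F" unfolding F[symmetric] by simp
      fix a b x assume ab: "a \<in> cube" "b \<in> cube" and x: "x \<in> ?F" "x \<in> open_segment a b"
      have "a $ j = v $ j \<and> b $ j = v $ j" if "j \<noteq> i" for j
        using open_segment_cube_coord[OF x(2) ab, of j] x(1) that v1[of j] by simp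
      then show "a \<in> ?F" "b \<in> ?F" using ab by auto
    qed auto
    moreover have "v \<noteq> v + 2 *\<^sub>R ?u" using v1[of i] by (auto simp: axis_eq_0_iff)
    then have "aff_dim (closed_segment v (v + 2 *\<^sub>R ?u)) = 1"
      by (simp add: segment_convex_hull aff_dim_convex_hull)
    ultimately show ?thesis unfolding edge_of_def F by simp
  qed
  ultimately show ?thesis unfolding primitive_edge_direction_def by (intro conjI exI[of _ 2]) auto
qed

definition edge_midpoints :: "(real^'n) set" where
  "edge_midpoints = {x. \<exists>i. x $ i = 0 \<and> (\<forall>j. j \<noteq> i \<longrightarrow> \<bar>x $ j\<bar> = 1)}"

lemma chiseling_cube_eq_hull: "chiseling (cube :: (real^'n) set) 1 = convex hull edge_midpoints"
proof -
  have "{v + real 1 *\<^sub>R u | v u. v extreme_point_of cube \<and> primitive_edge_direction cube v u}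
      = (edge_midpoints :: (real^'n) set)"
  proof (intro equalityI subsetI)
    fix x :: "real^'n"
    assume "x \<in> {v + real 1 *\<^sub>R u | v u. v extreme_point_of cube \<and> primitive_edge_direction cube v u}"
    then obtain v u where x: "x = v + u" and v: "v extreme_point_of cube"
      and "primitive_edge_direction cube v u" by auto
    then obtain i where "u = axis i (- (v $ i))" using primitive_edge_direction_cubeD by blast
    then show "x \<in> edge_midpoints"
      using v unfolding x edge_midpoints_def extreme_point_of_cube
      by (auto simp: axis_def intro!: exI[of _ i])
  next
    fix x :: "real^'n" assume "x \<in> edge_midpoints"
    then obtain i where i: "x $ i = 0" "\<And>j. j \<noteq> i \<Longrightarrow> \<bar>x $ j\<bar> = 1"
      unfolding edge_midpoints_def by auto
    define v where "v = x + axis i 1"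
    have "v extreme_point_of cube"
      unfolding extreme_point_of_cube v_def using i by (auto simp: axis_def)
    moreover have "x = v + real 1 *\<^sub>R axis i (- (v $ i))"
      using i(1) by (simp add: v_def vec_eq_iff axis_def)
    ultimately show
      "x \<in> {v + real 1 *\<^sub>R u | v u. v extreme_point_of cube \<and> primitive_edge_direction cube v u}"
      using primitive_edge_direction_cubeI[of v i] by blast
  qed
  then show ?thesis unfolding chiseling_def by simp
qed

section \<open>The convex hull of the edge midpoints\<close>

text \<open>
  The condition on the sum is \<open>\<bar>x\<^sub>1\<bar> + \<dots> + \<bar>x\<^sub>d\<bar> \<le> d - 1\<close>, written in terms of the distances
  \<open>1 - \<bar>x\<^sub>i\<bar>\<close> to the facets: these become barycentric weights in \<open>cut_face_subset_hull\<close> and, scaled by \<open>t\<close>, the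
  parts of a bounded composition when lattice points are counted.
\<close>

definition cut_cube :: "(real^'n) set" where
  "cut_cube = {x. (\<forall>i. \<bar>x $ i\<bar> \<le> 1) \<and> 1 \<le> (\<Sum>i\<in>UNIV. 1 - \<bar>x $ i\<bar>)}"

lemma convex_cut_cube: "convex (cut_cube :: (real^'n) set)"
  unfolding convex_def
proof (intro ballI allI impI)
  fix x y :: "real^'n" and u v :: real
  assume x: "x \<in> cut_cube" and y: "y \<in> cut_cube" and uv: "0 \<le> u" "0 \<le> v" "u + v = 1"
  have le: "\<bar>(u *\<^sub>R x + v *\<^sub>R y) $ i\<bar> \<le> u * \<bar>x $ i\<bar> + v * \<bar>y $ i\<bar>" for i
    using abs_triangle_ineq[of "u * x $ i" "v * y $ i"] uv by (simp add: abs_mult)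
  have split: "1 - (u * a + v * b) = u * (1 - a) + v * (1 - b)" for a b :: real
    using uv by (simp add: algebra_simps)
  have "\<bar>(u *\<^sub>R x + v *\<^sub>R y) $ i\<bar> \<le> 1" for i
  proof -
    have "0 \<le> u * (1 - \<bar>x $ i\<bar>) + v * (1 - \<bar>y $ i\<bar>)"
      using x y uv by (intro add_nonneg_nonneg mult_nonneg_nonneg) (auto simp: cut_cube_def)
    then show ?thesis using le[of i] split[of "\<bar>x $ i\<bar>" "\<bar>y $ i\<bar>"] by linarith
  qed
  moreover have "1 \<le> (\<Sum>i\<in>UNIV. 1 - \<bar>(u *\<^sub>R x + v *\<^sub>R y) $ i\<bar>)"
  proof -
    have "1 = u * 1 + v * 1" using uv by simp
    also have "\<dots> \<le> u * (\<Sum>i\<in>UNIV. 1 - \<bar>x $ i\<bar>) + v * (\<Sum>i\<in>UNIV. 1 - \<bar>y $ i\<bar>)"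
      using x y uv by (intro add_mono mult_left_mono) (auto simp: cut_cube_def)
    also have "\<dots> = (\<Sum>i\<in>UNIV. 1 - (u * \<bar>x $ i\<bar> + v * \<bar>y $ i\<bar>))"
      by (simp only: split sum.distrib sum_distrib_left)
    also have "\<dots> \<le> (\<Sum>i\<in>UNIV. 1 - \<bar>(u *\<^sub>R x + v *\<^sub>R y) $ i\<bar>)"
      by (intro sum_mono diff_left_mono le)
    finally show ?thesis .
  qed
  ultimately show "u *\<^sub>R x + v *\<^sub>R y \<in> cut_cube" unfolding cut_cube_def by blast
qed

text \<open>
  On the cutting facets the numbers \<open>1 - \<bar>x\<^sub>i\<bar>\<close> are themselves barycentric coordinates: they are
  weights for the points \<open>m i\<close> obtained from the sign vector of \<open>x\<close> by setting entry \<open>i\<close> to 0,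
  as entry \<open>j\<close> of the weighted sum is the sign of \<open>x\<^sub>j\<close> times \<open>1 - (1 - \<bar>x\<^sub>j\<bar>)\<close>.
\<close>

lemma cut_face_subset_hull:
  fixes x :: "real^'n"
  assumes x: "\<And>i. \<bar>x $ i\<bar> \<le> 1" and sum: "(\<Sum>i\<in>UNIV. 1 - \<bar>x $ i\<bar>) = 1"
  shows "x \<in> convex hull edge_midpoints"
proof -
  define s where "s j = (if x $ j \<ge> 0 then 1 else - 1 :: real)" for j
  define m :: "'n \<Rightarrow> real^'n" where "m i = (\<chi> j. if j = i then 0 else s j)" for i
  have "x $ j = (\<Sum>i\<in>UNIV. (1 - \<bar>x $ i\<bar>) *\<^sub>R m i) $ j" for j
  proof -
    have "(\<Sum>i\<in>UNIV. (1 - \<bar>x $ i\<bar>) *\<^sub>R m i) $ j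
        = (\<Sum>i\<in>UNIV. (1 - \<bar>x $ i\<bar>) * s j - (if i = j then (1 - \<bar>x $ j\<bar>) * s j else 0))"
      by (auto simp: m_def intro!: sum.cong)
    also have "\<dots> = (\<Sum>i\<in>UNIV. 1 - \<bar>x $ i\<bar>) * s j - (1 - \<bar>x $ j\<bar>) * s j"
      unfolding sum_subtractf[of "\<lambda>i. (1 - \<bar>x $ i\<bar>) * s j"] sum_distrib_right[symmetric] by simp
    also have "\<dots> = \<bar>x $ j\<bar> * s j" unfolding sum by (simp add: algebra_simps)
    also have "\<dots> = x $ j" by (simp add: s_def)
    finally show ?thesis by simp
  qed
  then have "x = (\<Sum>i\<in>UNIV. (1 - \<bar>x $ i\<bar>) *\<^sub>R m i)" unfolding vec_eq_iff ..
  moreover have "m i \<in> convex hull edge_midpoints" for i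
    by (rule hull_inc) (auto simp: edge_midpoints_def m_def s_def intro!: exI[of _ i])
  then have "(\<Sum>i\<in>UNIV. (1 - \<bar>x $ i\<bar>) *\<^sub>R m i) \<in> convex hull edge_midpoints"
    using x sum by (intro convex_sum convex_convex_hull) auto
  ultimately show ?thesis by simp
qed

text \<open>
  For the inclusion of \<open>cut_cube\<close> in the hull, the absolute values of the entries of \<open>x\<close> are
  enlarged until the sum of the facet distances is exactly 1. All vertices of the resulting
  coordinate box lie on the cutting facets, which \<open>cut_face_subset_hull\<close> covers, and \<open>x\<close> lies in
  the box.
\<close>

lemma hull_edge_midpoints: "convex hull edge_midpoints = (cut_cube :: (real^'n) set)"
proof
  have "x \<in> cut_cube" if x: "x \<in> edge_midpoints" for x :: "real^'n"
  proof -
    obtain i where i: "x $ i = 0" "\<And>j. j \<noteq> i \<Longrightarrow> \<bar>x $ j\<bar> = 1"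
      using x unfolding edge_midpoints_def by auto
    then have le: "\<bar>x $ j\<bar> \<le> 1" for j by (cases "j = i") auto
    have "1 - \<bar>x $ i\<bar> \<le> (\<Sum>i\<in>UNIV. 1 - \<bar>x $ i\<bar>)"
      using le by (intro member_le_sum) auto
    then show ?thesis using le i(1) unfolding cut_cube_def by simp
  qed
  then show "convex hull edge_midpoints \<subseteq> (cut_cube :: (real^'n) set)"
    using convex_cut_cube by (intro hull_minimal) auto
  show "(cut_cube :: (real^'n) set) \<subseteq> convex hull edge_midpoints"
  proof
    fix x :: "real^'n" assume x: "x \<in> cut_cube"
    define s where "s = (\<Sum>i\<in>UNIV. 1 - \<bar>x $ i\<bar>)"
    have s: "s \<ge> 1" using x by (simp add: s_def cut_cube_def)
    \<comment> \<open>dividing all facet distances by their sum makes the sum 1 and moves no entry inwards\<close>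
    define y :: "real^'n" where "y = (\<chi> i. 1 - (1 - \<bar>x $ i\<bar>) / s)"
    have x1: "\<bar>x $ i\<bar> \<le> 1" for i using x by (simp add: cut_cube_def)
    have y: "\<bar>x $ i\<bar> \<le> y $ i" "y $ i \<le> 1" for i
    proof -
      have "(1 - \<bar>x $ i\<bar>) / s \<le> (1 - \<bar>x $ i\<bar>) / 1"
        using s x1[of i] by (intro divide_left_mono) auto
      then show "\<bar>x $ i\<bar> \<le> y $ i" by (simp add: y_def)
      show "y $ i \<le> 1" using s x1[of i] by (simp add: y_def)
    qed
    have sum_y: "(\<Sum>i\<in>UNIV. 1 - y $ i) = 1"
      using s by (simp add: y_def s_def flip: sum_divide_distrib)
    have "z \<in> convex hull edge_midpoints" if "z extreme_point_of cbox (- y) y" for z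
    proof -
      have z: "\<bar>z $ i\<bar> = y $ i" for i
        using extreme_point_of_cbox_coord[OF that, of i] y[of i] by auto
      show ?thesis using y sum_y by (intro cut_face_subset_hull) (auto simp: z)
    qed
    then have "convex hull {z. z extreme_point_of cbox (- y) y} \<subseteq> convex hull edge_midpoints"
      by (intro hull_minimal convex_convex_hull) auto
    moreover have "cbox (- y) y = convex hull {z. z extreme_point_of cbox (- y) y}"
      by (intro Krein_Milman_Minkowski compact_cbox convex_box)
    moreover have "x \<in> cbox (- y) y"
      using y(1) by (simp add: mem_box_cart abs_le_iff minus_le_iff)
    ultimately show "x \<in> convex hull edge_midpoints" by auto
  qed
qed

lemma aff_dim_cut_cube:
  assumes "CARD('n::finite) \<ge> 2"
  shows "aff_dim (cut_cube :: (real^'n) set) = int CARD('n)"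
proof -
  have "box (\<chi> i. - 1/2) (\<chi> i. 1/2) \<subseteq> (cut_cube :: (real^'n) set)"
  proof
    fix x :: "real^'n" assume box: "x \<in> box (\<chi> i. - 1/2) (\<chi> i. 1/2)"
    have x: "\<bar>x $ i\<bar> \<le> 1/2" for i
    proof -
      have "- 1/2 < x $ i" "x $ i < 1/2" using box by (simp_all add: mem_box_cart)
      then show ?thesis by linarith
    qed
    have "1 \<le> (\<Sum>i\<in>(UNIV :: 'n set). 1/2 :: real)" using assms by simp
    also have "\<dots> \<le> (\<Sum>i\<in>UNIV. 1 - \<bar>x $ i\<bar>)"
    proof (rule sum_mono)
      show "1/2 \<le> 1 - \<bar>x $ i\<bar>" for i using x[of i] by linarith
    qed
    finally have "1 \<le> (\<Sum>i\<in>UNIV. 1 - \<bar>x $ i\<bar>)" .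
    moreover have "\<bar>x $ i\<bar> \<le> 1" for i using x[of i] by linarith
    ultimately show "x \<in> cut_cube" unfolding cut_cube_def by blast
  qed
  then have "box (\<chi> i. - 1/2) (\<chi> i. 1/2) \<subseteq> interior (cut_cube :: (real^'n) set)"
    by (simp add: interior_maximal open_box)
  moreover have "(0 :: real^'n) \<in> box (\<chi> i. - 1/2) (\<chi> i. 1/2)" by (simp add: mem_box_cart)
  ultimately show ?thesis by (subst aff_dim_nonempty_interior) auto
qed

section \<open>Counting lattice points\<close>

lemma finite_bounded_sum:
  assumes "finite I"
  shows "finite {y :: 'a \<Rightarrow> nat. (\<forall>i. i \<notin> I \<longrightarrow> y i = 0) \<and> sum y I \<le> m}"
proof (rule finite_subset)
  show "{y. (\<forall>i. i \<notin> I \<longrightarrow> y i = 0) \<and> sum y I \<le> m}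
     \<subseteq> {f. \<forall>i. (i \<in> I \<longrightarrow> f i \<in> {..m}) \<and> (i \<notin> I \<longrightarrow> f i = 0)}"
    using assms by (auto intro: order_trans[OF member_le_sum])
  show "finite {f :: 'a \<Rightarrow> nat. \<forall>i. (i \<in> I \<longrightarrow> f i \<in> {..m}) \<and> (i \<notin> I \<longrightarrow> f i = 0)}"
    using assms by (intro finite_set_of_finite_funs) auto
qed

text \<open>
  Stars and bars. Functions vanishing outside \<open>I\<close>, rather than functions on \<open>I\<close>, keep the type
  fixed in the induction on \<open>I\<close>; splitting off the value at the new point leads to the hockey-stick
  identity.
\<close>

lemma card_bounded_sum:
  assumes "finite I"
  shows "card {y :: 'a \<Rightarrow> nat. (\<forall>i. i \<notin> I \<longrightarrow> y i = 0) \<and> sum y I \<le> m} = (m + card I) choose card I"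
  using assms
proof (induction I arbitrary: m rule: finite_induct)
  case empty
  have "{y :: 'a \<Rightarrow> nat. (\<forall>i. i \<notin> {} \<longrightarrow> y i = 0) \<and> sum y {} \<le> m} = {\<lambda>_. 0}" by auto
  then show ?case by simp
next
  case (insert a I)
  let ?S = "\<lambda>I m. {y :: 'a \<Rightarrow> nat. (\<forall>i. i \<notin> I \<longrightarrow> y i = 0) \<and> sum y I \<le> m}"
  have bij: "bij_betw (\<lambda>(k, y). y(a := k)) (SIGMA k:{..m}. ?S I (m - k)) (?S (insert a I) m)"
  proof (rule bij_betw_byWitness[where f' = "\<lambda>y. (y a, y(a := 0))"])
    have upd: "(\<Sum>i\<in>I. if i = a then k else y i) = sum y I" for y :: "'a \<Rightarrow> nat" and k
      using insert.hyps by (intro sum.cong) auto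
    show "(\<lambda>(k, y). y(a := k)) ` (SIGMA k:{..m}. ?S I (m - k)) \<subseteq> ?S (insert a I) m"
      using insert.hyps by (auto simp: upd)
    show "(\<lambda>y. (y a, y(a := 0))) ` ?S (insert a I) m \<subseteq> (SIGMA k:{..m}. ?S I (m - k))"
      using insert.hyps by (auto simp: upd)
    show "\<forall>p\<in>SIGMA k:{..m}. ?S I (m - k). (\<lambda>y. (y a, y(a := 0))) ((\<lambda>(k, y). y(a := k)) p) = p"
      using insert.hyps by (auto simp: fun_eq_iff)
  qed auto
  have "card (?S (insert a I) m) = card (SIGMA k:{..m}. ?S I (m - k))"
    using bij_betw_same_card[OF bij] by simp
  also have "\<dots> = (\<Sum>k\<le>m. card (?S I (m - k)))"
    using insert.hyps by (subst card_SigmaI) (auto intro: finite_bounded_sum)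
  also have "\<dots> = (\<Sum>k\<le>m. (m - k + card I) choose card I)"
    using insert.IH by simp
  also have "\<dots> = (\<Sum>k\<le>m. (k + card I) choose card I)"
    using sum.nat_diff_reindex[of "\<lambda>k. (k + card I) choose card I" "Suc m"]
    by (simp add: lessThan_Suc_atMost)
  also have "\<dots> = (m + card (insert a I)) choose card (insert a I)"
  proof -
    have "(k + card I) choose card I = (card I + k) choose k" for k
      using binomial_symmetric[of "card I" "k + card I"] by (simp add: add.commute)
    moreover have "Suc (card I + m) choose m = (m + Suc (card I)) choose Suc (card I)"
      using binomial_symmetric[of m "Suc (card I + m)"] by (simp add: add.commute)
    ultimately show ?thesis
      using insert.hyps sum_choose_lower[of "card I" m] by simp
  qed
  finally show ?case .
qed

text \<open>
  In this form the count is also right for \<open>t = 0\<close>, where both sides vanish.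
\<close>

lemma card_sum_less:
  "card {y :: 'n::finite \<Rightarrow> nat. sum y UNIV < t} = (t + CARD('n) - 1) choose CARD('n)"
proof (cases t)
  case 0
  then show ?thesis by simp
next
  case (Suc m)
  then show ?thesis using card_bounded_sum[of "UNIV :: 'n set" m] by (simp add: less_Suc_eq_le)
qed

lemma card_int_box: "card {f :: 'n::finite \<Rightarrow> int. \<forall>i. \<bar>f i\<bar> \<le> int t} = (2 * t + 1) ^ CARD('n)"
proof -
  have "{f :: 'n \<Rightarrow> int. \<forall>i. \<bar>f i\<bar> \<le> int t} = (\<Pi>\<^sub>E i\<in>UNIV. {- int t..int t})"
    by (auto simp: PiE_def Pi_def abs_le_iff) (metis minus_le_iff)+
  moreover have "nat (2 * int t + 1) = 2 * t + 1" by simp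
  ultimately show ?thesis by (simp add: card_PiE)
qed

text \<open>
  The lattice points of the dilated cube that the chiseling removes. Since all summands are
  nonnegative, a sum below \<open>t\<close> forces \<open>\<bar>f i\<bar> > 0\<close>, so such a point is given by the set of its positive
  entries, chosen freely, and the distances \<open>y i = t - \<bar>f i\<bar>\<close>.
\<close>

lemma card_corners:
  "card {f :: 'n::finite \<Rightarrow> int. (\<forall>i. \<bar>f i\<bar> \<le> int t) \<and> (\<Sum>i\<in>UNIV. int t - \<bar>f i\<bar>) < int t}
   = 2 ^ CARD('n) * ((t + CARD('n) - 1) choose CARD('n))"
  (is "card ?B = _")
proof -
  let ?Y = "{y :: 'n \<Rightarrow> nat. sum y UNIV < t}"
  let ?g = "\<lambda>(S, y) i. if i \<in> S then int t - int (y i) else int (y i) - int t"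
  have "bij_betw ?g (UNIV \<times> ?Y) ?B"
  proof (rule bij_betw_byWitness[where f' = "\<lambda>f. ({i. f i > 0}, \<lambda>i. nat (int t - \<bar>f i\<bar>))"])
    have less: "y i < t" if "sum y UNIV < t" for y :: "'n \<Rightarrow> nat" and i
      using member_le_sum[of i UNIV y] that by simp
    have absg: "\<bar>if P then int t - int (y i) else int (y i) - int t\<bar> = int t - int (y i)"
      if "sum y UNIV < t" for y :: "'n \<Rightarrow> nat" and i P
      using less[OF that(1), of i] by auto
    show "\<forall>p\<in>UNIV \<times> ?Y. ({i. ?g p i > 0}, \<lambda>i. nat (int t - \<bar>?g p i\<bar>)) = p"
      using less less_asym by (auto simp: absg) blast
    show "?g ` (UNIV \<times> ?Y) \<subseteq> ?B"
      by (auto simp: absg simp flip: of_nat_sum)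
    have small: "int t - \<bar>f i\<bar> < int t" if "f \<in> ?B" for f i
    proof -
      have "int t - \<bar>f i\<bar> \<le> (\<Sum>i\<in>UNIV. int t - \<bar>f i\<bar>)"
        using that by (intro member_le_sum) auto
      also have "\<dots> < int t" using that by simp
      finally show ?thesis .
    qed
    show "\<forall>f\<in>?B. ?g ({i. f i > 0}, \<lambda>i. nat (int t - \<bar>f i\<bar>)) = f"
    proof (intro ballI ext)
      fix f i assume f: "f \<in> ?B"
      then have "\<bar>f i\<bar> \<le> int t" by blast
      then show "?g ({i. f i > 0}, \<lambda>i. nat (int t - \<bar>f i\<bar>)) i = f i"
        using small[OF f, of i] by auto
    qed
    show "(\<lambda>f. ({i. f i > 0}, \<lambda>i. nat (int t - \<bar>f i\<bar>))) ` ?B \<subseteq> UNIV \<times> ?Y"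
    proof clarsimp
      fix f :: "'n \<Rightarrow> int"
      assume f: "\<forall>i. \<bar>f i\<bar> \<le> int t" "(\<Sum>i\<in>UNIV. int t - \<bar>f i\<bar>) < int t"
      have "int (\<Sum>i\<in>UNIV. nat (int t - \<bar>f i\<bar>)) = (\<Sum>i\<in>UNIV. int t - \<bar>f i\<bar>)"
        using f(1) by simp
      then show "(\<Sum>i\<in>UNIV. nat (int t - \<bar>f i\<bar>)) < t" using f(2) by linarith
    qed
  qed
  then have "card ?B = card ((UNIV :: 'n set set) \<times> ?Y)" by (simp add: bij_betw_same_card)
  then show ?thesis
    by (simp add: card_cartesian_product card_sum_less card_Pow flip: Pow_UNIV)
qed

lemma card_cut_box:
  "real (card {f :: 'n::finite \<Rightarrow> int. (\<forall>i. \<bar>f i\<bar> \<le> int t) \<and> (\<Sum>i\<in>UNIV. int t - \<bar>f i\<bar>) \<ge> int t})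
   = (2 * real t + 1) ^ CARD('n) - 2 ^ CARD('n) * real ((t + CARD('n) - 1) choose CARD('n))"
  (is "real (card ?A) = _")
proof -
  let ?C = "{f :: 'n \<Rightarrow> int. \<forall>i. \<bar>f i\<bar> \<le> int t}"
  let ?B = "{f :: 'n \<Rightarrow> int. (\<forall>i. \<bar>f i\<bar> \<le> int t) \<and> (\<Sum>i\<in>UNIV. int t - \<bar>f i\<bar>) < int t}"
  have "card ?C > 0" unfolding card_int_box by simp
  then have fin: "finite ?C" using card_gt_0_iff by blast
  have "?A = ?C - ?B" by auto
  moreover have "?B \<subseteq> ?C" by auto
  ultimately have "card ?A = card ?C - card ?B" "card ?B \<le> card ?C"
    using fin by (simp_all add: card_Diff_subset card_mono finite_subset)
  then have "real (card ?A) = real (card ?C) - real (card ?B)" by simp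
  then show ?thesis unfolding card_int_box card_corners by (simp add: add.commute)
qed

lemma Collect_range_eq_image: "{x \<in> range e. P x} = e ` {f. P (e f)}"
  by auto

lemma lattice_count_cut_cube:
  "lattice_count (cut_cube :: (real^'n::finite) set) t =
     card {f :: 'n \<Rightarrow> int. (\<forall>i. \<bar>f i\<bar> \<le> int t) \<and> int t \<le> (\<Sum>i\<in>UNIV. int t - \<bar>f i\<bar>)}"
    (is "_ = card ?A")
proof -
  let ?e = "\<lambda>f :: 'n \<Rightarrow> int. (\<chi> i. real_of_int (f i)) :: real^'n"
  have dilate: "x \<in> (*\<^sub>R) (real t) ` cut_cube \<longleftrightarrow>
      (\<forall>i. \<bar>x $ i\<bar> \<le> real t) \<and> real t \<le> (\<Sum>i\<in>UNIV. real t - \<bar>x $ i\<bar>)" for x :: "real^'n"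
  proof (cases "t = 0")
    case True
    have "1 \<le> CARD('n)" using zero_less_card_finite[where 'a = 'n] by linarith
    then have "(0 :: real^'n) \<in> cut_cube" by (simp add: cut_cube_def)
    then have "x \<in> (*\<^sub>R) (real t) ` cut_cube \<longleftrightarrow> x = 0" using True by auto
    then show ?thesis using True by (auto simp: vec_eq_iff)
  next
    case False
    have sc: "(\<Sum>i\<in>UNIV. real t - \<bar>x $ i\<bar>) = real t * (\<Sum>i\<in>UNIV. 1 - \<bar>x $ i / t\<bar>)"
      using False by (simp add: sum_distrib_left right_diff_distrib)
    have "x \<in> (*\<^sub>R) (real t) ` cut_cube \<longleftrightarrow> (1 / real t) *\<^sub>R x \<in> cut_cube"
      using False by (auto simp: image_iff intro!: bexI[of _ "(1 / real t) *\<^sub>R x"])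
    also have "\<dots> \<longleftrightarrow> (\<forall>i. \<bar>x $ i\<bar> \<le> real t) \<and> real t \<le> (\<Sum>i\<in>UNIV. real t - \<bar>x $ i\<bar>)"
      unfolding sc cut_cube_def using False by (simp add: pos_divide_le_eq)
    finally show ?thesis .
  qed
  have int: "?e f \<in> (*\<^sub>R) (real t) ` cut_cube \<longleftrightarrow> f \<in> ?A" for f
  proof -
    have "real_of_int (int t) \<le> of_int (\<Sum>i\<in>UNIV. int t - \<bar>f i\<bar>) \<longleftrightarrow> int t \<le> (\<Sum>i\<in>UNIV. int t - \<bar>f i\<bar>)"
      by (simp only: of_int_le_iff)
    moreover have "real_of_int \<bar>f i\<bar> \<le> of_int (int t) \<longleftrightarrow> \<bar>f i\<bar> \<le> int t" for i
      by (simp only: of_int_le_iff)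
    ultimately show ?thesis unfolding dilate by simp
  qed
  have "x \<in> range ?e" if "x \<in> int_lattice" for x :: "real^'n"
    by (rule image_eqI[of _ _ "\<lambda>i. \<lfloor>x $ i\<rfloor>"]) (use that in \<open>auto simp: vec_eq_iff int_lattice_def\<close>)
  moreover have "?e f \<in> int_lattice" for f by (simp add: int_lattice_def)
  ultimately have "int_lattice = range ?e" by blast
  then have "(*\<^sub>R) (real t) ` cut_cube \<inter> int_lattice = {x \<in> range ?e. x \<in> (*\<^sub>R) (real t) ` cut_cube}"
    by (simp only: Collect_conj_eq Collect_mem_eq Int_commute)
  also have "\<dots> = ?e ` {f. ?e f \<in> (*\<^sub>R) (real t) ` cut_cube}"
    by (rule Collect_range_eq_image)
  also have "\<dots> = ?e ` ?A"
    unfolding int Collect_mem_eq ..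
  finally have "(*\<^sub>R) (real t) ` cut_cube \<inter> int_lattice = ?e ` ?A" .
  moreover have "inj_on ?e ?A" by (auto simp: inj_on_def vec_eq_iff)
  ultimately show ?thesis unfolding lattice_count_def by (simp add: card_image)
qed

lemma lattice_count_cut_cube_eq:
  "real (lattice_count (cut_cube :: (real^'n::finite) set) t) =
     (2 * real t + 1) ^ CARD('n) - 2 ^ CARD('n) * real ((t + CARD('n) - 1) choose CARD('n))"
  unfolding lattice_count_cut_cube by (rule card_cut_box)

section \<open>Eulerian polynomials of type B\<close>

text \<open>
  Defined by the recursion that makes them the numerators of the series of odd powers
  \<open>(2 t + 1)\<^sup>n\<close>, see \<open>odd_powers_fps\<close>.
\<close>

primrec eulerB_poly :: "nat \<Rightarrow> real poly" where
  "eulerB_poly 0 = 1"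
| "eulerB_poly (Suc n) =
     [:1, 2 * real n + 1:] * eulerB_poly n + [:0, 2, -2:] * pderiv (eulerB_poly n)"

abbreviation eulerB :: "nat \<Rightarrow> nat \<Rightarrow> real" where
  "eulerB n k \<equiv> coeff (eulerB_poly n) k"

lemma eulerB_Suc_0: "eulerB (Suc n) 0 = eulerB n 0"
  by simp

lemma eulerB_Suc_Suc:
  "eulerB (Suc n) (Suc k) =
     (2 * real k + 3) * eulerB n (Suc k) + (2 * (real n - real k) + 1) * eulerB n k"
  by (cases k) (auto simp: coeff_pderiv algebra_simps)

lemma eulerB_0 [simp]: "eulerB n 0 = 1"
  by (induction n) (simp_all del: eulerB_poly.simps(2) add: eulerB_Suc_0)

lemma eulerB_eq_0: "n < k \<Longrightarrow> eulerB n k = 0"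
proof (induction n arbitrary: k)
  case 0
  then show ?case by simp
next
  case (Suc n)
  then obtain j where "k = Suc j" "n < j" by (cases k) auto
  with Suc.IH show ?case by (simp add: eulerB_Suc_Suc del: eulerB_poly.simps(2))
qed

text \<open>
  The recurrence is invariant under \<open>k \<mapsto> n - k\<close>: its two coefficients change places.
\<close>

lemma eulerB_sym: "k \<le> n \<Longrightarrow> eulerB n (n - k) = eulerB n k"
proof (induction n arbitrary: k)
  case 0
  then show ?case by simp
next
  case (Suc n)
  have top: "eulerB (Suc n) (Suc n) = 1"
    using Suc.IH[of 0] by (simp add: eulerB_Suc_Suc eulerB_eq_0 del: eulerB_poly.simps(2))
  show ?case
  proof (cases k)
    case 0
    then show ?thesis using top by (simp del: eulerB_poly.simps(2))
  next
    case k: (Suc j)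
    show ?thesis
    proof (cases "j = n")
      case True
      then show ?thesis using top k by (simp del: eulerB_poly.simps(2))
    next
      case False
      then have j: "j < n" using k Suc.prems by simp
      define i where "i = n - Suc j"
      have i: "n = Suc (i + j)" using j unfolding i_def by simp
      have e1: "eulerB n (Suc i) = eulerB n j"
        using Suc.IH[of j] i by simp
      have e2: "eulerB n i = eulerB n (Suc j)"
        using Suc.IH[of "Suc j"] i by simp
      have "Suc n - k = Suc i" using i k by simp
      then show ?thesis
        unfolding k using i e1 e2
        by (simp add: eulerB_Suc_Suc algebra_simps del: eulerB_poly.simps(2))
    qed
  qed
qed

text \<open>
  The three coefficients in the difference of two consecutive entries sum to zero, so that it can
  be written through differences of the previous row, with nonnegative factors.
\<close>

lemma eulerB_mono:
  assumes "2 * k + 1 \<le> n"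
  shows "eulerB n k \<le> eulerB n (Suc k)"
  using assms
proof (induction n arbitrary: k)
  case 0
  then show ?case by simp
next
  case (Suc n)
  show ?case
  proof (cases k)
    case 0
    have "0 \<le> eulerB n 1"
      using Suc.IH[of 0] by (cases n) auto
    then show ?thesis using 0 by (simp add: eulerB_Suc_Suc del: eulerB_poly.simps(2))
  next
    case k: (Suc j)
    have jk: "eulerB n j \<le> eulerB n k"
      using Suc.IH[of j] Suc.prems k by simp
    have kk: "eulerB n j \<le> eulerB n (Suc k) \<and> (eulerB n k \<le> eulerB n (Suc k) \<or> 2 * k = n)"
    proof (cases "2 * k = n")
      case True
      \<comment> \<open>here \<open>k\<close> is the centre of row \<open>n\<close>, and its neighbours agree by symmetry\<close>
      then have "eulerB n j = eulerB n (Suc k)"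
        using eulerB_sym[of j n] k by (metis add_diff_cancel_right' add_Suc_right add_Suc_shift le_add1 mult_2)
      then show ?thesis using True by simp
    next
      case False
      then show ?thesis using Suc.IH[of k] Suc.prems jk by fastforce
    qed
    have "eulerB (Suc n) (Suc k) - eulerB (Suc n) k =
       (2 * real k + 3) * (eulerB n (Suc k) - eulerB n j)
       + 2 * (real n - 2 * real k) * (eulerB n k - eulerB n j)"
      unfolding k by (simp add: eulerB_Suc_Suc algebra_simps del: eulerB_poly.simps(2))
    also have "\<dots> \<ge> 0"
      using kk jk Suc.prems by (intro add_nonneg_nonneg mult_nonneg_nonneg) auto
    finally show ?thesis by simp
  qed
qed

lemma eulerB_antimono:
  assumes "k < n" "n \<le> 2 * k + 1"
  shows "eulerB n (Suc k) \<le> eulerB n k"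
proof -
  have "eulerB n (n - Suc k) \<le> eulerB n (Suc (n - Suc k))"
    using assms by (intro eulerB_mono) linarith
  moreover have "Suc (n - Suc k) = n - k" using assms by simp
  ultimately show ?thesis
    using assms eulerB_sym[of k n] eulerB_sym[of "Suc k" n] by simp
qed

text \<open>
  This margin is what the subtraction of \<open>2\<^sup>n z\<close> from the Eulerian polynomial consumes.
\<close>

lemma eulerB_1_ge: "2 \<le> n \<Longrightarrow> 2 ^ n + 1 \<le> eulerB n 1"
proof (induction n rule: dec_induct)
  case base
  show ?case by (simp add: numeral_2_eq_2 eulerB_Suc_Suc pderiv_pCons)
next
  case (step m)
  have "eulerB (Suc m) 1 = 3 * eulerB m 1 + (2 * real m + 1)"
    using eulerB_Suc_Suc[of m 0] by (simp del: eulerB_poly.simps(2))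
  moreover have "(0 :: real) \<le> 2 ^ m" by simp
  ultimately show ?case using step.IH by (simp only: power_Suc)
qed

text \<open>
  Multiplying the coefficients of \<open>F\<close> by \<open>2 t + 1\<close> amounts to applying \<open>F \<mapsto> F + 2 z F'\<close>, and the
  recursion of \<^const>\<open>eulerB_poly\<close> is this operator after clearing the denominator \<open>(1 - z)\<^sup>n\<^sup>+\<^sup>1\<close>.
\<close>

lemma odd_powers_fps:
  "(1 - fps_X) ^ (n + 1) * Abs_fps (\<lambda>t. (2 * real t + 1) ^ n) = fps_of_poly (eulerB_poly n)"
proof (induction n)
  case 0
  have "(1 - fps_X) * Abs_fps (\<lambda>t. 1) = (1 :: real fps)"
    by (metis fps_inverse_one_minus_fps_X inverse_mult_eq_1' fps_sub_nth fps_one_nth fps_X_nth diff_zero zero_neq_one)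
  then show ?case by simp
next
  case (Suc n)
  define F where "F = Abs_fps (\<lambda>t. (2 * real t + 1) ^ n)"
  define B where "B = fps_of_poly (eulerB_poly n)"
  define Y where "Y = (1 - fps_X :: real fps)"
  have IH: "B = Y ^ (n + 1) * F" using Suc.IH unfolding F_def B_def Y_def by simp
  have step: "Abs_fps (\<lambda>t. (2 * real t + 1) ^ Suc n) = F + 2 * fps_X * fps_deriv F"
    unfolding F_def
    by (rule fps_ext) (simp add: mult.assoc numeral_fps_const algebra_simps)
  have dY: "fps_deriv Y = -1" unfolding Y_def by simp
  have dB: "fps_deriv B = Y ^ (n + 1) * fps_deriv F - of_nat (n + 1) * Y ^ n * F"
    unfolding IH fps_deriv_mult fps_deriv_power' dY by (simp add: algebra_simps)
  have pX1: "fps_of_poly [:1, 2 * real n + 1:] = 1 + (2 * of_nat n + 1) * fps_X"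
    by (rule fps_ext) (simp add: coeff_pCons numeral_fps_const fps_of_nat [symmetric] split: nat.split)
  have pX2: "fps_of_poly [:0, 2, -2 :: real:] = 2 * fps_X * (1 - fps_X)"
    by (rule fps_ext) (simp add: coeff_pCons numeral_fps_const mult.assoc split: nat.split)
  have "fps_of_poly (eulerB_poly (Suc n)) =
    (1 + (2 * of_nat n + 1) * fps_X) * B + 2 * fps_X * (1 - fps_X) * fps_deriv B"
    unfolding B_def eulerB_poly.simps fps_of_poly_add fps_of_poly_mult fps_of_poly_pderiv
      pX1 pX2 ..
  also have "fps_X = 1 - Y" unfolding Y_def by simp
  also have "(1 + (2 * of_nat n + 1) * (1 - Y)) * B + 2 * (1 - Y) * (1 - (1 - Y)) * fps_deriv B
     = Y ^ (Suc n + 1) * (F + 2 * (1 - Y) * fps_deriv F)"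
    unfolding dB unfolding IH by (simp add: algebra_simps)
  also have "1 - Y = fps_X" unfolding Y_def by simp
  finally show ?case unfolding step Y_def by simp
qed

section \<open>The Ehrhart polynomial and the \<open>h\<^sup>*\<close>-polynomial\<close>

lemma binomial_column_fps:
  "(1 - fps_X) ^ (d + 1) * Abs_fps (\<lambda>t. real ((t + d) choose d)) = 1"
proof (induction d)
  case 0
  have "(1 - fps_X) * Abs_fps (\<lambda>t. 1) = (1 :: real fps)"
    by (metis fps_inverse_one_minus_fps_X inverse_mult_eq_1' fps_sub_nth fps_one_nth fps_X_nth diff_zero zero_neq_one)
  then show ?case by simp
next
  case (Suc d)
  have "(1 - fps_X) * Abs_fps (\<lambda>t. real ((t + Suc d) choose Suc d))
     = Abs_fps (\<lambda>t. real ((t + d) choose d))"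
  proof (rule fps_ext)
    fix t show "((1 - fps_X) * Abs_fps (\<lambda>t. real ((t + Suc d) choose Suc d))) $ t =
       Abs_fps (\<lambda>t. real ((t + d) choose d)) $ t"
      by (cases t) (simp_all add: algebra_simps)
  qed
  then have "(1 - fps_X) ^ (Suc d + 1) * Abs_fps (\<lambda>t. real ((t + Suc d) choose Suc d))
     = (1 - fps_X) ^ (d + 1) * Abs_fps (\<lambda>t. real ((t + d) choose d))"
    by (simp only: add_Suc power_Suc2 mult.assoc)
  then show ?case using Suc by (simp only:)
qed

lemma shifted_binomial_column_fps:
  assumes "d > 0"
  shows "(1 - fps_X) ^ (d + 1) * Abs_fps (\<lambda>t. real ((t + d - 1) choose d)) = fps_X"
proof -
  have "Abs_fps (\<lambda>t. real ((t + d - 1) choose d)) =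
     fps_X * Abs_fps (\<lambda>t. real ((t + d) choose d))"
  proof (rule fps_ext)
    fix t show "Abs_fps (\<lambda>t. real ((t + d - 1) choose d)) $ t =
     (fps_X * Abs_fps (\<lambda>t. real ((t + d) choose d))) $ t"
      using assms by (cases t) simp_all
  qed
  then show ?thesis
    using binomial_column_fps[of d] by (metis mult.left_commute mult.right_neutral)
qed

text \<open>
  The polynomial \<open>2\<^sup>d t (t + 1) \<cdots> (t + d - 1) / d!\<close>, which counts the removed lattice points.
\<close>

definition corner_poly :: "nat \<Rightarrow> real poly" where
  "corner_poly d = smult (2 ^ d / fact d) (pochhammer [:0, 1:] d)"

lemma poly_pochhammer: "poly (pochhammer p n) x = pochhammer (poly p x) n" for x :: real
  by (induction n) (simp_all add: pochhammer_Suc)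

lemma poly_corner: "d > 0 \<Longrightarrow> poly (corner_poly d) (real t) = 2 ^ d * real ((t + d - 1) choose d)"
  unfolding corner_poly_def
  by (simp add: poly_pochhammer binomial_gbinomial gbinomial_pochhammer' of_nat_diff)

lemma coeff_corner_1:
  assumes "d > 0"
  shows "coeff (corner_poly d) 1 = 2 ^ d / real d"
proof -
  obtain e where d: "d = Suc e" using assms by (cases d) auto
  have "coeff (pochhammer [:0, 1 :: real:] d) 1 = coeff (pochhammer [:1, 1:] e) 0"
    unfolding d by (simp add: pochhammer_rec one_pCons)
  also have "\<dots> = fact e"
    by (simp add: poly_0_coeff_0 [symmetric] poly_pochhammer pochhammer_fact)
  finally have "coeff (corner_poly d) 1 = 2 ^ d * fact e / fact d"
    unfolding corner_poly_def by simp
  moreover have "fact d = real d * fact e" unfolding d by simp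
  ultimately show ?thesis by simp
qed

lemma coeff_odd_power_1: "coeff ([:1, 2 :: real:] ^ d) 1 = 2 * real d"
proof -
  have "coeff ([:1, 2 :: real:] ^ d) 1 = poly (pderiv ([:1, 2:] ^ d)) 0"
    by (simp add: poly_0_coeff_0 coeff_pderiv)
  also have "\<dots> = 2 * real d"
    by (simp add: pderiv_power pderiv_pCons)
  finally show ?thesis .
qed

lemma two_mult_square_less_power: "n \<ge> 7 \<Longrightarrow> 2 * n ^ 2 < 2 ^ n" for n :: nat
proof (induction n rule: dec_induct)
  case (step n)
  have "2 * (Suc n) ^ 2 \<le> 4 * n ^ 2"
  proof -
    have "2 * n + 1 \<le> n * n" 
      using step mult_le_mono1[of 7 n n] by linarith
    then show ?thesis by (simp add: power2_eq_square)
  qed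
  then show ?case using step by simp
qed simp

lemma ehrhart_poly_eqI:
  assumes "\<And>t. poly p (real t) = real (lattice_count P t)"
  shows "ehrhart_poly P = p"
  unfolding ehrhart_poly_def
proof (rule the_equality)
  fix q assume q: "\<forall>t. poly q (real t) = real (lattice_count P t)"
  show "q = p"
  proof (rule ccontr)
    assume "q \<noteq> p"
    then have "finite {x. poly (q - p) x = 0}" by (intro poly_roots_finite) simp
    moreover have "range real \<subseteq> {x. poly (q - p) x = 0}" using q assms by auto
    ultimately have "finite (range real)" by (rule rev_finite_subset)
    then have "finite (UNIV :: nat set)" by (rule finite_imageD) (rule inj_of_nat)
    then show False by simp
  qed
qed (use assms in simp)

lemma hstar_poly_eqI:
  assumes "(1 - fps_X) ^ (nat (aff_dim P) + 1) * Abs_fps (\<lambda>t. real (lattice_count P t)) = fps_of_poly h"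
  shows "hstar_poly P = h"
proof -
  define U where "U = (1 - fps_X :: real fps) ^ (nat (aff_dim P) + 1)"
  have U0: "fps_nth U 0 \<noteq> 0" by (simp add: U_def fps_nth_power_0)
  have inv: "inverse U * U = 1" by (rule inverse_mult_eq_1[OF U0])
  have iff: "f = g / U \<longleftrightarrow> U * f = g" for f g
  proof -
    have "U * (g * inverse U) = g * (inverse U * U)" "(U * f) * inverse U = f * (inverse U * U)"
      by (simp_all only: mult_ac)
    then show ?thesis unfolding fps_divide_unit[OF U0] inv by (metis mult_1_right)
  qed
  show ?thesis
    unfolding hstar_poly_def U_def[symmetric] iff assms[folded U_def] fps_of_poly_eq_iff
    by (rule the_equality) auto
qed

lemma ehrhart_poly_cut_cube:
  "ehrhart_poly (cut_cube :: (real^'n::finite) set) = [:1, 2:] ^ CARD('n) - corner_poly CARD('n)"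
proof (rule ehrhart_poly_eqI)
  fix t
  have "poly [:1, 2:] (real t) = 2 * real t + 1" by simp
  then show "poly ([:1, 2:] ^ CARD('n) - corner_poly CARD('n)) (real t) =
      real (lattice_count (cut_cube :: (real^'n) set) t)"
    by (simp only: poly_diff poly_power poly_corner[OF zero_less_card_finite] lattice_count_cut_cube_eq)
qed

lemma hstar_poly_cut_cube:
  assumes "CARD('n::finite) \<ge> 2"
  shows "hstar_poly (cut_cube :: (real^'n) set) = eulerB_poly CARD('n) - monom (2 ^ CARD('n)) 1"
proof (rule hstar_poly_eqI)
  let ?d = "CARD('n)"
  let ?U = "(1 - fps_X :: real fps) ^ (?d + 1)"
  have dim: "nat (aff_dim (cut_cube :: (real^'n) set)) = ?d"
    using aff_dim_cut_cube[OF assms] by simp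
  have "Abs_fps (\<lambda>t. real (lattice_count (cut_cube :: (real^'n) set) t)) =
     Abs_fps (\<lambda>t. (2 * real t + 1) ^ ?d)
     - fps_const (2 ^ ?d) * Abs_fps (\<lambda>t. real ((t + ?d - 1) choose ?d))"
    by (rule fps_ext) (simp add: lattice_count_cut_cube_eq)
  then have "?U * Abs_fps (\<lambda>t. real (lattice_count (cut_cube :: (real^'n) set) t)) =
     ?U * Abs_fps (\<lambda>t. (2 * real t + 1) ^ ?d)
     - fps_const (2 ^ ?d) * (?U * Abs_fps (\<lambda>t. real ((t + ?d - 1) choose ?d)))"
    by (simp only: right_diff_distrib mult.left_commute[of ?U])
  also have "\<dots> = fps_of_poly (eulerB_poly ?d) - fps_const (2 ^ ?d) * fps_X"
    by (simp only: odd_powers_fps shifted_binomial_column_fps[OF zero_less_card_finite])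
  also have "\<dots> = fps_of_poly (eulerB_poly ?d - monom (2 ^ ?d) 1)"
    by (simp add: fps_of_poly_diff fps_of_poly_monom)
  finally show "(1 - fps_X) ^ (nat (aff_dim (cut_cube :: (real^'n) set)) + 1) *
      Abs_fps (\<lambda>t. real (lattice_count (cut_cube :: (real^'n) set) t)) =
      fps_of_poly (eulerB_poly ?d - monom (2 ^ ?d) 1)"
    unfolding dim .
qed

theorem theorem4p2:
  assumes "CARD('n::finite) \<ge> 7"
  shows "ehrhart_unimodal (chiseling (cube :: (real^'n) set) 1) \<and>
         \<not> ehrhart_positive (chiseling (cube :: (real^'n) set) 1)"
proof
  let ?d = "CARD('n)"
  have eq: "chiseling (cube :: (real^'n) set) 1 = cut_cube"
    by (simp only: chiseling_cube_eq_hull hull_edge_midpoints)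
  have dim: "nat (aff_dim (cut_cube :: (real^'n) set)) = ?d"
    using aff_dim_cut_cube[where 'n = 'n] assms by simp
  define h where "h k = eulerB ?d k - (if k = 1 then 2 ^ ?d else 0)" for k
  have h: "coeff (hstar_poly (cut_cube :: (real^'n) set)) k = h k" for k
    using hstar_poly_cut_cube[where 'n = 'n] assms by (simp add: h_def)
  have "h k \<le> h (Suc k)" if "k < ?d div 2" for k
  proof (cases "k = 0")
    case True
    then show ?thesis using eulerB_1_ge[of ?d] assms by (simp add: h_def)
  next
    case False
    have "2 * k + 1 \<le> ?d" using that by linarith
    then have "eulerB ?d k \<le> eulerB ?d (Suc k)" by (rule eulerB_mono)
    moreover have "h k \<le> eulerB ?d k" "h (Suc k) = eulerB ?d (Suc k)"
      using False by (simp_all add: h_def)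
    ultimately show ?thesis by linarith
  qed
  moreover have "h (Suc k) \<le> h k" if "?d div 2 \<le> k" "k < ?d" for k
  proof -
    have "eulerB ?d (Suc k) \<le> eulerB ?d k"
      by (rule eulerB_antimono) (use that in linarith)+
    \<comment> \<open>as \<open>d div 2 \<ge> 3\<close>, the lowered coefficient is not among those compared here\<close>
    moreover have "k \<noteq> 0" "k \<noteq> 1" using that assms by linarith+
    ultimately show ?thesis by (simp add: h_def)
  qed
  ultimately show "ehrhart_unimodal (chiseling (cube :: (real^'n) set) 1)"
    unfolding eq ehrhart_unimodal_def dim h by (intro exI[of _ "?d div 2"] conjI allI impI) auto
  have "real (2 * ?d ^ 2) < real (2 ^ ?d)"
    using two_mult_square_less_power[OF assms] by (simp only: of_nat_less_iff)
  then have "2 * real ?d < 2 ^ ?d / real ?d"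
    by (simp add: field_simps power2_eq_square)
  then have "coeff (ehrhart_poly (cut_cube :: (real^'n) set)) 1 < 0"
    unfolding ehrhart_poly_cut_cube coeff_diff coeff_odd_power_1
      coeff_corner_1[OF zero_less_card_finite] by simp
  then have "\<not> coeff (ehrhart_poly (cut_cube :: (real^'n) set)) 1 > 0" by linarith
  moreover have "1 \<le> ?d" using assms by simp
  ultimately show "\<not> ehrhart_positive (chiseling (cube :: (real^'n) set) 1)"
    unfolding eq ehrhart_positive_def dim by blast
qed

end
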